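(* Let $(x^k)_{k\in\mathbb{N}}$ and $(\alpha_k)_{k\in\mathbb{N}}$ be the sequences generated by Method 1. The following statements hold: (i) If $S_*\neq\emptyset$, then $(x^k)_{k\in\mathbb{N}}$ is weakly convergent to a point in $S_*$. Moreover, $\lim_{k\to\infty}(f+g)(x^k)=\min_{x\in\mathcal{H}}(f+g)(x)$. (ii) If $S_*=\emptyset$, then $\lim_{k\to\infty}\|x^k\|=+\infty$ and $\lim_{k\to\infty}(f+g)(x^k)=\inf_{x\in\mathcal{H}}(f+g)(x)$.
   Context: Let $\mathcal{H}$ be a real Hilbert space with inner product $\langle\cdot,\cdot\rangle$ and induced norm $\|\cdot\|$; $\overline{\mathbb{R}}:=\mathbb{R}\cup\{+\infty\}$ and $\operatorname{dom}h:=\{x\in\mathcal{H}: h(x)<+\infty\}$. Standing assumptions. (A1) $f,g:\mathcal{H}\to\overline{\mathbb{R}}$ are proper lower semicontinuous convex functions with $\operatorname{dom}g\subseteq\operatorname{dom}f$. (A2) $f$ is Fréchet differentiable on an open set containing $\operatorname{dom}g$; its gradient $\nabla f$ is uniformly continuous on any bounded subset of $\operatorname{dom}g$ and maps any bounded subset of $\operatorname{dom}g$ to a bounded set in $\mathcal{H}$. $S_*$ denotes the (possibly empty) set of minimizers of $f+g$ over $\mathcal{H}$. The proximal operator is $\operatorname{prox}_{\alpha g}:=(\mathrm{Id}+\alpha\,\partial g)^{-1}$, which is single-valued and defined on all of $\mathcal{H}$ with values in $\operatorname{dom}g$. For $x\in\operatorname{dom}g$ and $\alpha>0$, $J(x,\alpha):=\operatorname{prox}_{\alpha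 g}(x-\alpha\nabla f(x))$. Linesearch 1 $(x,\sigma,\theta,\delta)$, for $x\in\operatorname{dom}g$, $\sigma>0$, $\theta\in(0,1)$, $\delta\in(0,1/2)$: set $\alpha=\sigma$; while $\alpha\|\nabla f(J(x,\alpha))-\nabla f(x)\|>\delta\|J(x,\alpha)-x\|$, replace $\alpha$ by $\theta\alpha$; output $\alpha$. Method 1: choose $x^0\in\operatorname{dom}g$, $\sigma>0$, $\theta\in(0,1)$, $\delta\in(0,1/2)$. For $k=0,1,2,\dots$ let $\alpha_k$ be the output of Linesearch 1 $(x^k,\sigma,\theta,\delta)$ and set $x^{k+1}=J(x^k,\alpha_k)$; the stop criterion is $x^{k+1}=x^k$. The statement concerns the infinite sequences $(x^k)_{k\in\mathbb{N}}$, $(\alpha_k)_{k\in\mathbb{N}}$ so generated. *)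

theory Defs
  imports "HOL-Analysis.Analysis" "HOL-Library.While_Combinator"
begin

text \<open>
  A real Hilbert space is a type of class \<open>{real_inner, complete_space}\<close>. Functions with values
  in the reals extended by plus infinity are rendered as functions into \<^typ>\<open>ereal\<close>; the value
  minus infinity is excluded in \<open>proper_fun\<close>.
\<close>

definition edom :: "('a \<Rightarrow> ereal) \<Rightarrow> 'a set" where
  "edom h = {x. h x < \<infinity>}"

definition proper_fun :: "('a \<Rightarrow> ereal) \<Rightarrow> bool" where
  "proper_fun h \<longleftrightarrow> (\<forall>x. h x \<noteq> -\<infinity>) \<and> edom h \<noteq> {}"

definition lsc_fun :: "('a::topological_space \<Rightarrow> ereal) \<Rightarrow> bool" where
  "lsc_fun h \<longleftrightarrow> (\<forall>x. h x \<le> Liminf (at x) h)"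

definition convex_fun :: "('a::real_vector \<Rightarrow> ereal) \<Rightarrow> bool" where
  "convex_fun h \<longleftrightarrow>
     (\<forall>x y. \<forall>t\<in>{0<..<1::real}.
        h ((1 - t) *\<^sub>R x + t *\<^sub>R y) \<le> ereal (1 - t) * h x + ereal t * h y)"

text \<open>
  At a point of the interior of the domain of \<open>h\<close>, replacing \<open>h\<close> by its real part does not change
  it near that point, so this is the usual gradient (the Riesz representative of the Frechet
  derivative). It is only meaningful at points where \<open>h\<close> is differentiable in the sense of
  \<open>frechet_differentiable_on\<close>.
\<close>

definition gradient :: "('a::real_inner \<Rightarrow> ereal) \<Rightarrow> 'a \<Rightarrow> 'a" where
  "gradient h x = (THE D. GDERIV (\<lambda>y. real_of_ereal (h y)) x :> D)"

definition frechet_differentiable_on :: "('a::real_normed_vector \<Rightarrow> ereal) \<Rightarrow> 'a set \<Rightarrow> bool" where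
  "frechet_differentiable_on h U \<longleftrightarrow>
     open U \<and> U \<subseteq> edom h \<and> (\<forall>x\<in>U. (\<lambda>y. real_of_ereal (h y)) differentiable (at x))"

definition subdifferential :: "('a::real_inner \<Rightarrow> ereal) \<Rightarrow> 'a \<Rightarrow> 'a set" where
  "subdifferential h x = {v. \<forall>y. h x + ereal (v \<bullet> (y - x)) \<le> h y}"

text \<open>
  The resolvent of \<open>\<alpha> \<partial>h\<close>: the unique \<open>p\<close> with \<open>z \<in> p + \<alpha> \<partial>h p\<close>. Existence and uniqueness of
  \<open>p\<close> hold for proper lower semicontinuous convex \<open>h\<close> and \<open>\<alpha> > 0\<close>.
\<close>

definition prox :: "real \<Rightarrow> ('a::real_inner \<Rightarrow> ereal) \<Rightarrow> 'a \<Rightarrow> 'a" where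
  "prox \<alpha> h z = (THE p. \<exists>v\<in>subdifferential h p. z = p + \<alpha> *\<^sub>R v)"

definition fb_step :: "('a::real_inner \<Rightarrow> ereal) \<Rightarrow> ('a \<Rightarrow> ereal) \<Rightarrow> 'a \<Rightarrow> real \<Rightarrow> 'a" where
  "fb_step f g x \<alpha> = prox \<alpha> g (x - \<alpha> *\<^sub>R gradient f x)"

text \<open>
  The value is unspecified if the loop does not terminate; termination is not assumed anywhere.
\<close>

definition linesearch1 ::
    "('a::real_inner \<Rightarrow> ereal) \<Rightarrow> ('a \<Rightarrow> ereal) \<Rightarrow> 'a \<Rightarrow> real \<Rightarrow> real \<Rightarrow> real \<Rightarrow> real" where
  "linesearch1 f g x \<sigma> \<theta> \<delta> =
     while (\<lambda>\<alpha>. \<alpha> * norm (gradient f (fb_step f g x \<alpha>) - gradient f x)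
                  > \<delta> * norm (fb_step f g x \<alpha> - x))
           (\<lambda>\<alpha>. \<theta> * \<alpha>) \<sigma>"

text \<open>
  The stop criterion is not imposed: if \<open>x (Suc k) = x k\<close> for some \<open>k\<close>, the sequences are continued
  by the same recursion and are constant from then on.
\<close>

definition generated_by_method1 ::
    "('a::real_inner \<Rightarrow> ereal) \<Rightarrow> ('a \<Rightarrow> ereal) \<Rightarrow> real \<Rightarrow> real \<Rightarrow> real
      \<Rightarrow> (nat \<Rightarrow> 'a) \<Rightarrow> (nat \<Rightarrow> real) \<Rightarrow> bool" where
  "generated_by_method1 f g \<sigma> \<theta> \<delta> x \<alpha> \<longleftrightarrow>
     x 0 \<in> edom g \<and>
     (\<forall>k. \<alpha> k = linesearch1 f g (x k) \<sigma> \<theta> \<delta> \<and> x (Suc k) = fb_step f g (x k) (\<alpha> k))"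

definition minimizers :: "('a \<Rightarrow> ereal) \<Rightarrow> 'a set" where
  "minimizers h = {x. \<forall>y. h x \<le> h y}"

definition weakly_converges :: "(nat \<Rightarrow> 'a::real_inner) \<Rightarrow> 'a \<Rightarrow> bool" where
  "weakly_converges x p \<longleftrightarrow> (\<forall>y. (\<lambda>k. x k \<bullet> y) \<longlonglongrightarrow> p \<bullet> y)"

end

theory Submission
  imports Defs
begin

text \<open>
  Write \<open>\<phi> = f + g\<close>. Combining the subgradient inequalities for \<open>g\<close> at \<open>x (k + 1)\<close> and for \<open>f\<close> with
  the acceptance test of the linesearch gives, for all \<open>u\<close> in the domain of \<open>g\<close>,
  \<open>|x (k+1) - u|^2 + 2 \<alpha> (\<phi> (x (k+1)) - \<phi> u) + (1 - 2 \<delta>) |x k - x (k+1)|^2 \<le> |x k - u|^2\<close>.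
  So the values decrease, and the sequence is Fejer monotone with respect to every \<open>u\<close> whose value
  lies below all of them. If the values stayed above \<open>\<phi> u + \<epsilon>\<close>, the step sizes and the steps would tend
  to zero; then the last rejected trial step \<open>\<alpha> / \<theta>\<close> has a residual that is small even relative to
  \<open>\<alpha> / \<theta>\<close>, and this forces \<open>\<phi> (x (k+1)) \<le> \<phi> u + o(1)\<close>, a contradiction. Hence the values tend to
  the infimum in both cases. A bounded subsequence has a point lying in the closed convex hulls of
  all its tails; since sublevel sets are closed and convex, that point is a minimizer. This yields
  (ii), and with Fejer monotonicity and Opial's argument also (i).
\<close>

section \<open>Proximal points\<close>

text \<open>A proper lower semicontinuous convex function is encoded by its domain \<open>D\<close>
  and its real values \<open>G\<close> there. Sublevel sets are closed in the whole space, which is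
  lower semicontinuity of \<open>G\<close> extended by infinity.\<close>

locale closed_convex_function =
  fixes D :: "'a::{real_inner,complete_space} set" and G :: "'a \<Rightarrow> real"
  assumes nonempty: "D \<noteq> {}"
    and convex: "convex_on D G"
    and closed_sublevel: "\<And>M. closed {y\<in>D. G y \<le> M}"
begin

text \<open>Near a point of the domain the function is bounded below by lower semicontinuity;
  convexity propagates this to a lower bound of linear growth.\<close>

lemma linear_lower_bound:
  obtains a b where "b \<ge> 0" "\<And>y. y \<in> D \<Longrightarrow> a - b * norm (y - z) \<le> G y"
proof -
  obtain x0 where x0: "x0 \<in> D" using nonempty by blast
  have "open (- {y\<in>D. G y \<le> G x0 - 1})" using closed_sublevel by auto
  moreover have "x0 \<in> - {y\<in>D. G y \<le> G x0 - 1}" by simp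
  ultimately obtain r where r: "r > 0" and "ball x0 r \<subseteq> - {y\<in>D. G y \<le> G x0 - 1}"
    by (meson open_contains_ball)
  then have near: "G y > G x0 - 1" if "y \<in> D" "dist x0 y < r" for y
    using that by (force simp: subset_iff)
  have lin: "G x0 - 1 - (2 / r) * norm (y - x0) \<le> G y" if y: "y \<in> D" for y
  proof (cases "dist x0 y < r")
    case True
    with near[OF y] r show ?thesis
      by (smt (verit) divide_nonneg_pos mult_nonneg_nonneg norm_ge_zero)
  next
    case False
    \<comment> \<open>This choice puts \<open>?w\<close> at distance \<open>r / 2\<close> from
      \<open>x0\<close>, where the local bound applies.\<close>
    define t where "t = r / (2 * norm (y - x0))"
    have n: "norm (y - x0) \<ge> r" using False by (simp add: dist_norm norm_minus_commute)
    have t: "0 < t" "t < 1"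
      using n r zero_less_mult_iff[of 2 "norm (y - x0)"] by (auto simp: t_def divide_simps)
    let ?w = "(1 - t) *\<^sub>R x0 + t *\<^sub>R y"
    have w: "?w \<in> D"
      using convex x0 y t by (auto simp: convex_on_def intro!: convexD)
    have eq: "?w - x0 = t *\<^sub>R (y - x0)" by (simp add: algebra_simps)
    have "dist x0 ?w = norm (?w - x0)" by (simp add: dist_norm norm_minus_commute)
    also have "\<dots> = t * norm (y - x0)" using t unfolding eq by simp
    also have "\<dots> = r / 2" using n r by (auto simp: t_def)
    finally have "dist x0 ?w < r" using r by simp
    from near[OF w this] have "G x0 - 1 < G ?w" .
    also have "\<dots> \<le> (1 - t) * G x0 + t * G y"
      using convex_onD[OF convex _ _ x0 y, of t] t by simp
    finally have "t * (G x0 - G y) < 1" by (simp add: algebra_simps)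
    then have "G x0 - G y < 1 / t" using t by (simp add: field_simps)
    also have "1 / t = (2 / r) * norm (y - x0)" by (simp add: t_def)
    finally show ?thesis by simp
  qed
  show ?thesis
  proof
    show "2 / r \<ge> 0" using r by simp
    fix y assume y: "y \<in> D"
    have "norm (y - x0) \<le> norm (y - z) + norm (z - x0)"
      by (metis norm_triangle_ineq diff_add_cancel add_diff_eq)
    then have "(2 / r) * norm (y - x0) \<le> (2 / r) * norm (y - z) + (2 / r) * norm (z - x0)"
      using r by (metis mult_left_mono distrib_left divide_nonneg_pos less_imp_le zero_le_numeral)
    with lin[OF y]
    show "(G x0 - 1 - (2 / r) * norm (z - x0)) - (2 / r) * norm (y - z) \<le> G y" by simp
  qed
qed

text \<open>The quadratic term makes the objective strongly convex, so comparison with midpoints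
  shows that a minimizing sequence is Cauchy. Closed sublevel sets keep its limit in
  \<open>D\<close> and control the value there.\<close>

lemma proximal_minimizer_exists:
  assumes c: "c > 0"
  obtains p where "p \<in> D" "\<And>y. y \<in> D \<Longrightarrow> G p + c * (norm (p - z))\<^sup>2 \<le> G y + c * (norm (y - z))\<^sup>2"
proof -
  define m where "m y = G y + c * (norm (y - z))\<^sup>2" for y
  obtain a b where b: "b \<ge> 0" and lb: "\<And>y. y \<in> D \<Longrightarrow> a - b * norm (y - z) \<le> G y"
    using linear_lower_bound by metis
  \<comment> \<open>Completing the square: \<open>c * t\<^sup>2 - b * t\<close> is at least
    \<open>- b\<^sup>2 / (4 * c)\<close>.\<close>
  have below: "a - b\<^sup>2 / (4 * c) \<le> m y" if "y \<in> D" for y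
  proof -
    have "0 \<le> c * (norm (y - z) - b / (2 * c))\<^sup>2" using c by simp
    also have "\<dots> = c * (norm (y - z))\<^sup>2 - b * norm (y - z) + b\<^sup>2 / (4 * c)"
      using c by (simp add: field_simps power2_eq_square)
    finally show ?thesis using lb[OF that] by (simp add: m_def)
  qed
  then have bdd: "bdd_below (m ` D)" by (meson bdd_belowI2)
  define I where "I = Inf (m ` D)"
  have I_le: "I \<le> m y" if "y \<in> D" for y
    unfolding I_def using bdd that by (simp add: cINF_lower)
  have "\<exists>y\<in>D. m y < I + 1 / real (Suc n)" for n
    using cInf_lessD[of "m ` D" "I + 1 / real (Suc n)"] nonempty by (auto simp: I_def)
  then obtain y where yD: "\<And>n. y n \<in> D" and y: "\<And>n. m (y n) < I + 1 / real (Suc n)"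
    by metis
  have conv: "convex D" using convex by (simp add: convex_on_def)
  have gap: "(c / 2) * (norm (y i - y j))\<^sup>2 \<le> 1 / real (Suc i) + 1 / real (Suc j)" for i j
  proof -
    let ?w = "(1 - 1/2) *\<^sub>R y i + (1/2) *\<^sub>R y j"
    have w: "?w \<in> D" by (rule convexD[OF conv]) (auto simp: yD)
    have "G ?w \<le> (G (y i) + G (y j)) / 2"
      using convex_onD[OF convex _ _ yD yD, of "1/2" i j] by (simp add: field_simps)
    moreover have "(norm (?w - z))\<^sup>2
      = (norm (y i - z))\<^sup>2 / 2 + (norm (y j - z))\<^sup>2 / 2 - (norm (y i - y j))\<^sup>2 / 4"
      unfolding power2_norm_eq_inner by (simp add: algebra_simps inner_commute add_divide_distrib diff_divide_distrib)
    ultimately have "G ?w + c * (norm (?w - z))\<^sup>2 \<le> (G (y i) + G (y j)) / 2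
        + c * ((norm (y i - z))\<^sup>2 / 2 + (norm (y j - z))\<^sup>2 / 2 - (norm (y i - y j))\<^sup>2 / 4)"
      by simp
    then have "m ?w \<le> (m (y i) + m (y j)) / 2 - ((c / 2) * (norm (y i - y j))\<^sup>2) / 2"
      unfolding m_def by (simp add: algebra_simps add_divide_distrib)
    then have "2 * m ?w \<le> (m (y i) + m (y j)) - (c / 2) * (norm (y i - y j))\<^sup>2" by argo
    with I_le[OF w] y[of i] y[of j] show ?thesis by linarith
  qed
  have "Cauchy y"
  proof (rule metric_CauchyI)
    fix e :: real assume e: "e > 0"
    then have "c / 4 * e\<^sup>2 > 0" using c by simp
    then obtain N where N: "1 / real (Suc N) < c / 4 * e\<^sup>2"
      using nat_approx_posE by blast
    have "dist (y i) (y j) < e" if "i \<ge> N" "j \<ge> N" for i j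
    proof -
      have "1 / real (Suc i) \<le> 1 / real (Suc N)" "1 / real (Suc j) \<le> 1 / real (Suc N)"
        using that by (auto simp: field_simps)
      with gap[of i j] N have "(c / 2) * (norm (y i - y j))\<^sup>2 < (c / 2) * e\<^sup>2" by linarith
      then have "(norm (y i - y j))\<^sup>2 < e\<^sup>2" using c by simp
      then show ?thesis using e by (simp add: dist_norm power_less_imp_less_base)
    qed
    then show "\<exists>N. \<forall>i\<ge>N. \<forall>j\<ge>N. dist (y i) (y j) < e" by blast
  qed
  then obtain p where p: "y \<longlonglongrightarrow> p" using Cauchy_convergent_iff convergent_def by blast
  define L where "L = I - c * (norm (p - z))\<^sup>2"
  have "(\<lambda>n. I + 1 / real (Suc n) - c * (norm (y n - z))\<^sup>2) \<longlonglongrightarrow> I + 0 - c * (norm (p - z))\<^sup>2"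
    by (intro tendsto_intros p LIMSEQ_Suc[OF lim_1_over_n])
  then have lim: "(\<lambda>n. I + 1 / real (Suc n) - c * (norm (y n - z))\<^sup>2) \<longlonglongrightarrow> L"
    by (simp add: L_def)
  \<comment> \<open>The bounds on \<open>G (y n)\<close> vary with \<open>n\<close> and only tend to
    \<open>L\<close>; the slack \<open>e\<close> gives one closed sublevel set that eventually
    contains the sequence.\<close>
  have sub: "p \<in> {v\<in>D. G v \<le> L + e}" if "e > 0" for e
  proof (rule Lim_in_closed_set[OF closed_sublevel _ _ p])
    have "\<forall>\<^sub>F n in sequentially. I + 1 / real (Suc n) - c * (norm (y n - z))\<^sup>2 < L + e"
      using order_tendstoD(2)[OF lim] that by simp
    then show "\<forall>\<^sub>F n in sequentially. y n \<in> {v\<in>D. G v \<le> L + e}"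
    proof eventually_elim
      case (elim n)
      with y[of n] have "G (y n) \<le> L + e" by (simp add: m_def)
      with yD show ?case by simp
    qed
  qed simp
  have pD: "p \<in> D" using sub[of 1] by simp
  have "G p \<le> L" by (rule field_le_epsilon) (use sub in auto)
  then have "m p \<le> I" by (simp add: m_def L_def)
  with I_le pD show ?thesis using that[of p] unfolding m_def by force
qed

text \<open>First-order condition for the minimizer with weight \<open>1 / (2 * c)\<close>: compare
  \<open>p\<close> with points of the segment towards \<open>y\<close>, divide by \<open>t\<close>
  and let \<open>t\<close> tend to 0.\<close>

lemma proximal_point_exists:
  assumes c: "c > 0"
  obtains p where "p \<in> D" "\<And>y. y \<in> D \<Longrightarrow> G p + ((z - p) /\<^sub>R c) \<bullet> (y - p) \<le> G y"
proof -
  obtain p where p: "p \<in> D"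
    and min: "\<And>y. y \<in> D \<Longrightarrow> G p + (1 / (2 * c)) * (norm (p - z))\<^sup>2 \<le> G y + (1 / (2 * c)) * (norm (y - z))\<^sup>2"
    using proximal_minimizer_exists[of "1 / (2 * c)" z] c by auto
  have "G p + ((z - p) /\<^sub>R c) \<bullet> (y - p) \<le> G y" if y: "y \<in> D" for y
  proof -
    have step: "G p + ((z - p) /\<^sub>R c) \<bullet> (y - p) \<le> G y + t * ((norm (y - p))\<^sup>2 / (2 * c))"
      if t: "0 < t" "t < 1" for t
    proof -
      let ?w = "(1 - t) *\<^sub>R p + t *\<^sub>R y"
      have w: "?w \<in> D"
        using convex p y t by (auto simp: convex_on_def intro!: convexD)
      have G: "G ?w \<le> (1 - t) * G p + t * G y"
        using convex_onD[OF convex _ _ p y, of t] t by simp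
      have "(norm (?w - z))\<^sup>2 = (norm (p - z))\<^sup>2 - 2 * t * ((z - p) \<bullet> (y - p)) + t\<^sup>2 * (norm (y - p))\<^sup>2"
        unfolding power2_norm_eq_inner by (simp add: algebra_simps inner_commute power2_eq_square)
      then have eq: "(1 / (2 * c)) * (norm (?w - z))\<^sup>2 = (1 / (2 * c)) * (norm (p - z))\<^sup>2
          - t * (((z - p) /\<^sub>R c) \<bullet> (y - p)) + t * (t * ((norm (y - p))\<^sup>2 / (2 * c)))"
        using c by (simp add: divide_simps power2_eq_square)
      have "t * (G p + ((z - p) /\<^sub>R c) \<bullet> (y - p)) \<le> t * (G y + t * ((norm (y - p))\<^sup>2 / (2 * c)))"
        using min[OF w] G unfolding eq by (simp add: algebra_simps)
      then show ?thesis using t by simp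
    qed
    have "((\<lambda>t. G y + t * ((norm (y - p))\<^sup>2 / (2 * c))) \<longlongrightarrow> G y + 0 * ((norm (y - p))\<^sup>2 / (2 * c))) (at_right 0)"
      by (intro tendsto_intros)
    then have "((\<lambda>t. G y + t * ((norm (y - p))\<^sup>2 / (2 * c))) \<longlongrightarrow> G y) (at_right 0)" by simp
    moreover have "\<forall>\<^sub>F t in at_right 0. G p + ((z - p) /\<^sub>R c) \<bullet> (y - p) \<le> G y + t * ((norm (y - p))\<^sup>2 / (2 * c))"
      using eventually_at_right_real[of 0 1] by (rule eventually_mono) (use step in auto)
    ultimately show ?thesis
      by (intro tendsto_lowerbound) auto
  qed
  with p that show ?thesis by blast
qed

end

section \<open>Hilbert space consequences: Riesz representation and nested convex sets\<close>

text \<open>The Riesz representative of \<open>L\<close> is the proximal point of \<open>-L\<close> at the origin.\<close>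

lemma riesz_representation:
  fixes L :: "'a::{real_inner,complete_space} \<Rightarrow> real"
  assumes L: "bounded_linear L"
  obtains d where "\<And>h. L h = h \<bullet> d"
proof -
  interpret L: bounded_linear L by fact
  interpret closed_convex_function UNIV "\<lambda>y. - L y"
  proof
    show "convex_on UNIV (\<lambda>y. - L y)" by (simp add: convex_on_def L.add L.scaleR)
    have "closed {y. - L y \<le> M}" for M
      by (intro closed_Collect_le continuous_intros linear_continuous_on L)
    then show "closed {y \<in> UNIV. - L y \<le> M}" for M by simp
  qed simp
  obtain p where p: "- L p + ((0 - p) /\<^sub>R 1) \<bullet> (y - p) \<le> - L y" for y
    using proximal_point_exists[of 1 0] by auto
  show ?thesis
  proof
    fix h
    \<comment> \<open>Moving away from \<open>p\<close> by \<open>h\<close> and by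
      \<open>- h\<close> gives the two opposite inequalities.\<close>
    show "L h = h \<bullet> p"
      using p[of "p + h"] p[of "p - h"] by (simp add: L.add L.diff inner_commute)
  qed
qed

text \<open>The points of least norm of the sets have increasing bounded norms, and the obtuse angle
  inequality turns convergence of the squared norms into a Cauchy sequence of points.\<close>

lemma nested_closed_convex_Inter:
  fixes C :: "nat \<Rightarrow> 'a::{real_inner,complete_space} set"
  assumes closed: "\<And>n. closed (C n)" and convex: "\<And>n. convex (C n)" and ne: "\<And>n. C n \<noteq> {}"
    and dec: "decseq C" and bdd: "bounded (C 0)"
  obtains p where "\<And>n. p \<in> C n"
proof -
  have "\<exists>p\<in>C n. \<forall>y\<in>C n. p \<bullet> (y - p) \<ge> 0" for n
  proof -
    \<comment> \<open>The zero function on \<open>C n\<close> encodes its indicator; the proximal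
      point at the origin is then the point of least norm.\<close>
    interpret closed_convex_function "C n" "\<lambda>_. 0"
    proof
      show "convex_on (C n) (\<lambda>_. 0)" using convex by (simp add: convex_on_def)
      show "closed {y \<in> C n. 0 \<le> M}" for M :: real using closed by (cases "0 \<le> M") auto
    qed (rule ne)
    show ?thesis using proximal_point_exists[of 1 0] by (metis add_0 diff_0 inner_minus_left inverse_1 neg_le_0_iff_le scaleR_one zero_less_one)
  qed
  then obtain p where pC: "\<And>n. p n \<in> C n" and p: "\<And>n y. y \<in> C n \<Longrightarrow> p n \<bullet> (y - p n) \<ge> 0"
    by metis
  have sub: "C j \<subseteq> C i" if "i \<le> j" for i j using dec that by (simp add: decseq_def)
  have gap: "(norm (p j - p i))\<^sup>2 \<le> (norm (p j))\<^sup>2 - (norm (p i))\<^sup>2" if "i \<le> j" for i j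
    using p[of "p j" i] pC[of j] sub[OF that]
    unfolding power2_norm_eq_inner by (auto simp: algebra_simps inner_commute)
  obtain K where K: "\<And>v. v \<in> C 0 \<Longrightarrow> norm v \<le> K" using bdd by (auto simp: bounded_iff)
  have "incseq (\<lambda>n. (norm (p n))\<^sup>2)"
    by (rule incseq_SucI) (metis gap le_SucI order_refl diff_ge_0_iff_ge order_trans zero_le_power2)
  moreover have "(norm (p n))\<^sup>2 \<le> K\<^sup>2" for n
    using K[of "p n"] pC[of n] sub[of 0 n] by (intro power_mono) auto
  ultimately have "convergent (\<lambda>n. (norm (p n))\<^sup>2)"
    by (metis incseq_convergent convergentI)
  then have Cn: "Cauchy (\<lambda>n. (norm (p n))\<^sup>2)" by (rule convergent_Cauchy)
  have "Cauchy p"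
  proof (rule CauchyI)
    fix e :: real assume e: "e > 0"
    then obtain N where N: "\<And>i j. i \<ge> N \<Longrightarrow> j \<ge> N \<Longrightarrow> norm ((norm (p i))\<^sup>2 - (norm (p j))\<^sup>2) < e\<^sup>2"
      using CauchyD[OF Cn, of "e\<^sup>2"] by auto
    have "norm (p i - p j) < e" if "i \<ge> N" "j \<ge> N" for i j
    proof -
      have "(norm (p i - p j))\<^sup>2 \<le> \<bar>(norm (p i))\<^sup>2 - (norm (p j))\<^sup>2\<bar>"
        using gap[of i j] gap[of j i] by (cases "i \<le> j") (auto simp: norm_minus_commute)
      also have "\<dots> < e\<^sup>2" using N[OF that] by simp
      finally show ?thesis using e by (simp add: power_less_imp_less_base)
    qed
    then show "\<exists>M. \<forall>m\<ge>M. \<forall>n\<ge>M. norm (p m - p n) < e" by blast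
  qed
  then obtain q where q: "p \<longlonglongrightarrow> q" using Cauchy_convergent_iff convergent_def by blast
  have "q \<in> C n" for n
    by (rule Lim_in_closed_set[OF closed _ _ q])
      (auto intro!: eventually_sequentiallyI[of n] dest: sub simp: pC subsetD[OF sub pC])
  then show ?thesis by (rule that)
qed

section \<open>Forward-backward steps with linesearch\<close>

text \<open>\<open>J_ineq\<close> says that \<open>(x - J x a) /\<^sub>R a - grad x\<close> is a
  subgradient of \<open>G\<close> at \<open>J x a\<close>, which is the optimality condition of the
  proximal step; \<open>grad_ineq\<close> makes \<open>grad x\<close> a subgradient of
  \<open>F\<close> on \<open>D\<close>.\<close>

locale forward_backward =
  fixes D :: "'a::{real_inner,complete_space} set"
    and F G :: "'a \<Rightarrow> real" and grad :: "'a \<Rightarrow> 'a" and J :: "'a \<Rightarrow> real \<Rightarrow> 'a"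
    and \<theta> \<delta> :: real
  assumes grad_ineq: "\<And>x y. x \<in> D \<Longrightarrow> y \<in> D \<Longrightarrow> F x + grad x \<bullet> (y - x) \<le> F y"
    and J_in: "\<And>x a. x \<in> D \<Longrightarrow> a > 0 \<Longrightarrow> J x a \<in> D"
    and J_ineq: "\<And>x a y. x \<in> D \<Longrightarrow> a > 0 \<Longrightarrow> y \<in> D \<Longrightarrow>
      G (J x a) + ((x - J x a) /\<^sub>R a - grad x) \<bullet> (y - J x a) \<le> G y"
    and grad_uniform: "\<And>B. B \<subseteq> D \<Longrightarrow> bounded B \<Longrightarrow> uniformly_continuous_on B grad"
    and grad_bounded: "\<And>B. B \<subseteq> D \<Longrightarrow> bounded B \<Longrightarrow> bounded (grad ` B)"
    and \<theta>: "0 < \<theta>" "\<theta> < 1" and \<delta>: "0 < \<delta>" "\<delta> < 1 / 2"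
begin

definition acceptable :: "'a \<Rightarrow> real \<Rightarrow> bool" where
  "acceptable x a \<longleftrightarrow> a * norm (grad (J x a) - grad x) \<le> \<delta> * norm (J x a - x)"

text \<open>Each subgradient inequality is tested at the other proximal point. Their sum and
  Cauchy-Schwarz give \<open>(b * norm A - a * norm B) * (norm A - norm B) \<le> 0\<close>, and the
  signs of the factors yield both claims.\<close>

lemma residual_mono:
  assumes x: "x \<in> D" and a: "0 < a" "a \<le> b"
  shows "norm (x - J x a) \<le> norm (x - J x b)"
    and "a * norm (x - J x b) \<le> b * norm (x - J x a)"
proof -
  have b: "b > 0" using a by simp
  define A where "A = x - J x a"
  define B where "B = x - J x b"
  have "(A /\<^sub>R a - grad x) \<bullet> (A - B) + (B /\<^sub>R b - grad x) \<bullet> (B - A) \<le> 0"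
    using J_ineq[OF x a(1) J_in[OF x b]] J_ineq[OF x b J_in[OF x a(1)]]
    by (simp add: A_def B_def)
  then have "(A /\<^sub>R a - B /\<^sub>R b) \<bullet> (A - B) \<le> 0"
    by (simp add: algebra_simps)
  then have "(a * b) * ((A /\<^sub>R a - B /\<^sub>R b) \<bullet> (A - B)) \<le> 0"
    using a b by (simp add: mult_le_0_iff)
  also have "(a * b) * ((A /\<^sub>R a - B /\<^sub>R b) \<bullet> (A - B))
    = b * (norm A)\<^sup>2 + a * (norm B)\<^sup>2 - (a + b) * (A \<bullet> B)"
    using a b unfolding power2_norm_eq_inner
    by (simp add: field_simps inner_diff_left inner_diff_right inner_commute)
  also have "\<dots> \<ge> b * (norm A)\<^sup>2 + a * (norm B)\<^sup>2 - (a + b) * (norm A * norm B)"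
    using norm_cauchy_schwarz[of A B] a b by simp
  also have "b * (norm A)\<^sup>2 + a * (norm B)\<^sup>2 - (a + b) * (norm A * norm B)
    = (b * norm A - a * norm B) * (norm A - norm B)"
    by (simp add: algebra_simps power2_eq_square)
  finally have *: "(b * norm A - a * norm B) * (norm A - norm B) \<le> 0" .
  show 1: "norm (x - J x a) \<le> norm (x - J x b)"
  proof (rule ccontr)
    assume "\<not> ?thesis"
    then have lt: "norm B < norm A" by (simp add: A_def B_def)
    have "a * norm B \<le> b * norm B" using a by (simp add: mult_right_mono)
    also have "\<dots> < b * norm A" using b lt by simp
    finally show False using * lt by (simp add: mult_le_0_iff)
  qed
  show "a * norm (x - J x b) \<le> b * norm (x - J x a)"
  proof (cases "norm A = norm B")
    case True
    then show ?thesis using a by (simp add: A_def B_def mult_right_mono)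
  next
    case False
    then have "norm A < norm B" using 1 by (simp add: A_def B_def)
    then have "b * norm A - a * norm B \<ge> 0" using * by (auto simp: mult_le_0_iff)
    then show ?thesis by (simp add: A_def B_def)
  qed
qed

text \<open>If every trial step failed, the residual \<open>norm (x - J x a) / a\<close> would be bounded by the
  variation of the gradient, hence tend to zero; but it increases as \<open>a\<close> decreases.\<close>

lemma linesearch_terminates:
  assumes x: "x \<in> D" and \<sigma>: "\<sigma> > 0"
  obtains n where "acceptable x (\<sigma> * \<theta> ^ n)"
proof -
  define b where "b n = \<sigma> * \<theta> ^ n" for n
  have b: "0 < b n" "b n \<le> \<sigma>" for n
    using \<sigma> \<theta> by (auto simp: b_def power_le_one)
  have "\<exists>n. acceptable x (b n)"
  proof (rule ccontr)
    assume "\<not> ?thesis"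
    then have fail: "\<delta> * norm (J x (b n) - x) < b n * norm (grad (J x (b n)) - grad x)" for n
      by (simp add: acceptable_def not_le)
    \<comment> \<open>By monotonicity of the residual, all trial points stay within the radius given
      by the first one, so the gradient hypotheses apply on one bounded set.\<close>
    define R where "R = norm (x - J x \<sigma>)"
    define B where "B = D \<inter> cball x R"
    have JB: "J x (b n) \<in> B" for n
      using residual_mono(1)[OF x b] J_in[OF x b(1)] by (simp add: B_def R_def dist_norm)
    have xB: "x \<in> B" using x by (simp add: B_def R_def)
    have B: "B \<subseteq> D" "bounded B" by (auto simp: B_def intro: bounded_Int)
    obtain C where C: "\<And>v. v \<in> B \<Longrightarrow> norm (grad v) \<le> C"
      using grad_bounded[OF B] by (auto simp: bounded_iff)
    have b0: "b \<longlonglongrightarrow> 0"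
      unfolding b_def using \<theta> by (auto intro!: tendsto_mult_right_zero LIMSEQ_realpow_zero)
    have bound: "norm (J x (b n) - x) \<le> b n * (2 * C / \<delta>)" for n
    proof -
      have "norm (grad (J x (b n)) - grad x) \<le> 2 * C"
        using C[OF JB, of n] C[OF xB] norm_triangle_ineq4[of "grad (J x (b n))" "grad x"] by linarith
      then have "b n * norm (grad (J x (b n)) - grad x) \<le> b n * (2 * C)"
        using b(1)[of n] by (intro mult_left_mono) auto
      then show ?thesis using fail[of n] \<delta> by (simp add: field_simps)
    qed
    have "(\<lambda>n. norm (J x (b n) - x)) \<longlonglongrightarrow> 0"
      by (rule tendsto_sandwich[OF _ always_eventually[OF allI, OF bound] tendsto_const
            tendsto_mult_left_zero[OF b0]]) simp
    then have "(\<lambda>n. dist (J x (b n)) x) \<longlonglongrightarrow> 0" by (simp add: dist_norm)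
    then have "(\<lambda>n. dist (grad (J x (b n))) (grad x)) \<longlonglongrightarrow> 0"
      using grad_uniform[OF B, unfolded uniformly_continuous_on_sequentially, rule_format,
          of "\<lambda>n. J x (b n)" "\<lambda>_. x"] JB xB by simp
    then have lim: "(\<lambda>n. (\<sigma> / \<delta>) * norm (grad (J x (b n)) - grad x)) \<longlonglongrightarrow> 0"
      by (intro tendsto_mult_right_zero) (simp add: dist_norm)
    \<comment> \<open>The residual divided by the step size is smallest at the largest step
      \<open>\<sigma>\<close>, so the vanishing bound for small steps applies to it.\<close>
    have "R \<le> (\<sigma> / \<delta>) * norm (grad (J x (b n)) - grad x)" for n
    proof -
      have "b n * R \<le> \<sigma> * norm (x - J x (b n))"
        unfolding R_def by (rule residual_mono(2)[OF x b])
      also have "\<dots> \<le> \<sigma> * ((b n / \<delta>) * norm (grad (J x (b n)) - grad x))"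
        using fail[of n] \<sigma> \<delta> by (intro mult_left_mono) (auto simp: field_simps norm_minus_commute)
      finally have "b n * R \<le> b n * ((\<sigma> / \<delta>) * norm (grad (J x (b n)) - grad x))"
        by (simp add: mult_ac)
      then show ?thesis using b(1)[of n] by (simp only: mult_le_cancel_left_pos)
    qed
    then have "R \<le> 0" by (intro LIMSEQ_le_const[OF lim]) auto
    \<comment> \<open>At a fixed point both sides of the test are 0, so the first trial cannot fail
      strictly.\<close>
    then have "J x (b 0) = x" by (simp add: R_def b_def)
    with fail[of 0] show False by simp
  qed
  with that show ?thesis unfolding b_def by blast
qed

lemma descent:
  assumes x: "x \<in> D" and a: "a > 0" and acc: "acceptable x a" and u: "u \<in> D"
  shows "(norm (J x a - u))\<^sup>2 + 2 * a * ((F (J x a) + G (J x a)) - (F u + G u))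
      + (1 - 2 * \<delta>) * (norm (x - J x a))\<^sup>2 \<le> (norm (x - u))\<^sup>2"
proof -
  define p where "p = J x a"
  have p: "p \<in> D" unfolding p_def using x a by (rule J_in)
  have "G p + ((x - p) /\<^sub>R a - grad x) \<bullet> (u - p) \<le> G u"
    unfolding p_def by (rule J_ineq[OF x a u])
  \<comment> \<open>Using the gradient inequality at \<open>p\<close> as well bounds
    \<open>F p\<close> without a Lipschitz constant; what remains is \<open>grad x - grad p\<close>,
    which the acceptance test controls.\<close>
  moreover have "F x + grad x \<bullet> (u - x) \<le> F u" "F p + grad p \<bullet> (x - p) \<le> F x"
    using grad_ineq x u p by auto
  ultimately have "F p + G p - (F u + G u) + ((x - p) \<bullet> (u - p)) / a \<le> (grad x - grad p) \<bullet> (x - p)"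
    by (simp add: algebra_simps divide_inverse)
  then have "a * (F p + G p - (F u + G u) + ((x - p) \<bullet> (u - p)) / a) \<le> a * ((grad x - grad p) \<bullet> (x - p))"
    using a by simp
  also have "\<dots> \<le> a * (norm (grad p - grad x) * norm (p - x))"
    using a norm_cauchy_schwarz[of "grad x - grad p" "x - p"] by (simp add: norm_minus_commute)
  also have "\<dots> \<le> \<delta> * (norm (x - p))\<^sup>2"
    using mult_right_mono[OF acc[unfolded acceptable_def, folded p_def] norm_ge_zero[of "p - x"]]
    by (simp add: power2_eq_square norm_minus_commute mult_ac)
  finally have "a * (F p + G p - (F u + G u)) + (x - p) \<bullet> (u - p) \<le> \<delta> * (norm (x - p))\<^sup>2"
    using a by (simp add: distrib_left)
  moreover have "2 * ((x - p) \<bullet> (u - p)) = (norm (x - p))\<^sup>2 + (norm (p - u))\<^sup>2 - (norm (x - u))\<^sup>2"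
    unfolding power2_norm_eq_inner by (simp add: algebra_simps inner_commute)
  ultimately show ?thesis unfolding p_def[symmetric] by (simp add: algebra_simps)
qed

text \<open>Compares the accepted step \<open>a\<close> with the preceding trial step \<open>a / \<theta>\<close>, whose residual is
  small whenever it was rejected. The function itself need not be continuous along vanishing steps,
  so the comparison uses the subgradient inequality between the two proximal points.\<close>

lemma accepted_value_bound:
  assumes x: "x \<in> D" and a: "a > 0" and acc: "acceptable x a" and u: "u \<in> D"
    and q: "q = J x (a / \<theta>)"
  shows "F (J x a) + G (J x a) \<le> F u + G u
    + norm (x - q) / (a / \<theta>) * (norm (u - q) + norm (x - q) / (2 * \<theta>))"
proof -
  define p where "p = J x a"
  define A where "A = x - p"
  define B where "B = x - q"
  have b: "a / \<theta> > 0" using a \<theta> by simp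
  have p: "p \<in> D" unfolding p_def using x a by (rule J_in)
  have qD: "q \<in> D" unfolding q using x b by (rule J_in)
  \<comment> \<open>Two stages: \<open>q\<close> is compared with \<open>u\<close>, then
    \<open>p\<close> with \<open>q\<close>.\<close>
  have "G q + ((x - q) /\<^sub>R (a / \<theta>) - grad x) \<bullet> (u - q) \<le> G u"
    unfolding q by (rule J_ineq[OF x b u])
  moreover have "G p + ((x - p) /\<^sub>R a - grad x) \<bullet> (q - p) \<le> G q"
    unfolding p_def by (rule J_ineq[OF x a qD])
  moreover have "F x + grad x \<bullet> (u - x) \<le> F u" "F p + grad p \<bullet> (x - p) \<le> F x"
    using grad_ineq x u p by auto
  ultimately have "F p + G p \<le> F u + G u - (B /\<^sub>R (a / \<theta>)) \<bullet> (u - q) - (A /\<^sub>R a) \<bullet> (A - B)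
      + (grad x - grad p) \<bullet> A"
    unfolding A_def B_def by (simp add: algebra_simps)
  moreover have "- ((B /\<^sub>R (a / \<theta>)) \<bullet> (u - q)) \<le> norm B / (a / \<theta>) * norm (u - q)"
    using norm_cauchy_schwarz[of "- (B /\<^sub>R (a / \<theta>))" "u - q"] a \<theta> by (simp add: divide_inverse mult_ac)
  \<comment> \<open>Since \<open>\<delta> < 1 / 2\<close>, half of the squared norm of
    \<open>A\<close> absorbs the gradient term, and the square of \<open>norm A - norm B\<close>
    absorbs the mixed term. The right side is just
    \<open>(norm B)\<^sup>2 / (2 * a)\<close>.\<close>
  moreover have "(grad x - grad p) \<bullet> A - (A /\<^sub>R a) \<bullet> (A - B) \<le> norm B / (a / \<theta>) * (norm B / (2 * \<theta>))"
  proof -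
    have "a * ((grad x - grad p) \<bullet> A) \<le> a * (norm (grad p - grad x) * norm A)"
      using a norm_cauchy_schwarz[of "grad x - grad p" A] by (simp add: norm_minus_commute)
    also have "\<dots> \<le> \<delta> * (norm A)\<^sup>2"
      using mult_right_mono[OF acc[unfolded acceptable_def, folded p_def] norm_ge_zero[of A]]
      by (simp add: A_def power2_eq_square norm_minus_commute mult_ac)
    also have "\<dots> \<le> (1 / 2) * (norm A)\<^sup>2" using \<delta> by (intro mult_right_mono) auto
    finally have "a * ((grad x - grad p) \<bullet> A) \<le> (norm A)\<^sup>2 / 2" by simp
    moreover have "A \<bullet> B \<le> norm A * norm B" by (rule norm_cauchy_schwarz)
    moreover have "0 \<le> (norm A - norm B)\<^sup>2" by simp
    ultimately have "a * ((grad x - grad p) \<bullet> A) - A \<bullet> (A - B) \<le> (norm B)\<^sup>2 / 2"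
      by (simp add: inner_diff_right power2_diff flip: power2_norm_eq_inner)
    then have "a * ((grad x - grad p) \<bullet> A - (A /\<^sub>R a) \<bullet> (A - B)) \<le> a * ((norm B)\<^sup>2 / (2 * a))"
      using a by (simp add: right_diff_distrib flip: mult.assoc)
    then have "(grad x - grad p) \<bullet> A - (A /\<^sub>R a) \<bullet> (A - B) \<le> (norm B)\<^sup>2 / (2 * a)"
      using a by (simp only: mult_le_cancel_left_pos)
    then show ?thesis using \<theta> by (simp add: power2_eq_square)
  qed
  ultimately show ?thesis
    unfolding p_def[symmetric] B_def by (simp add: distrib_left)
qed

end

text \<open>A step size other than \<open>\<sigma>\<close> comes from at least one reduction, so the
  trial before it was rejected. The linesearch facts are conditional on \<open>x k \<in> D\<close>
  because membership is itself proved by induction from them.\<close>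

locale forward_backward_sequence = forward_backward +
  fixes \<sigma> :: real and x :: "nat \<Rightarrow> 'a" and \<alpha> :: "nat \<Rightarrow> real"
  assumes x0: "x 0 \<in> D" and x_Suc: "\<And>k. x (Suc k) = J (x k) (\<alpha> k)"
    and \<alpha>_pos: "\<And>k. x k \<in> D \<Longrightarrow> \<alpha> k > 0"
    and accepted: "\<And>k. x k \<in> D \<Longrightarrow> acceptable (x k) (\<alpha> k)"
    and rejected: "\<And>k. x k \<in> D \<Longrightarrow> \<alpha> k \<noteq> \<sigma> \<Longrightarrow> \<not> acceptable (x k) (\<alpha> k / \<theta>)"
    and \<sigma>: "\<sigma> > 0"
begin

lemma x_in: "x k \<in> D"
  by (induction k) (simp_all add: x0 x_Suc J_in \<alpha>_pos)

lemma descent_seq: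
  assumes "u \<in> D"
  shows "(norm (x (Suc k) - u))\<^sup>2 + 2 * \<alpha> k * ((F (x (Suc k)) + G (x (Suc k))) - (F u + G u))
      + (1 - 2 * \<delta>) * (norm (x k - x (Suc k)))\<^sup>2 \<le> (norm (x k - u))\<^sup>2"
  unfolding x_Suc by (rule descent[OF x_in \<alpha>_pos[OF x_in] accepted[OF x_in] assms])

lemma values_decrease: "F (x (Suc k)) + G (x (Suc k)) \<le> F (x k) + G (x k)"
proof -
  have "0 \<le> (1 - 2 * \<delta>) * (norm (x k - x (Suc k)))\<^sup>2" using \<delta> by simp
  with descent_seq[OF x_in, of k k]
  have "2 * \<alpha> k * ((F (x (Suc k)) + G (x (Suc k))) - (F (x k) + G (x k))) \<le> 0"
    using zero_le_power2[of "norm (x (Suc k) - x k)"]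
    unfolding diff_self norm_zero zero_power2 by linarith
  with \<alpha>_pos[OF x_in, of k] show ?thesis by (simp add: mult_le_0_iff)
qed

lemma fejer:
  assumes u: "u \<in> D" and le: "F u + G u \<le> F (x (Suc k)) + G (x (Suc k))"
  shows "norm (x (Suc k) - u) \<le> norm (x k - u)"
proof -
  have "0 \<le> (1 - 2 * \<delta>) * (norm (x k - x (Suc k)))\<^sup>2" using \<delta> by simp
  moreover have "0 \<le> 2 * \<alpha> k * ((F (x (Suc k)) + G (x (Suc k))) - (F u + G u))"
    using \<alpha>_pos[OF x_in, of k] le by simp
  ultimately have "(norm (x (Suc k) - u))\<^sup>2 \<le> (norm (x k - u))\<^sup>2"
    using descent_seq[OF u, of k] by linarith
  then show ?thesis by (rule power2_le_imp_le) simp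
qed

text \<open>A gap between the values and \<open>F u + G u\<close> forces the step sizes and the steps to vanish, so
  that the preceding trial steps are eventually all rejected.\<close>

lemma values_approach_infimum:
  assumes u: "u \<in> D" and e: "e > 0"
  obtains k where "F (x k) + G (x k) < F u + G u + e"
proof (rule ccontr)
  assume "\<not> thesis"
  with that have gap: "F u + G u + e \<le> F (x k) + G (x k)" for k by (force simp: not_less)
  define d where "d k = (norm (x k - u))\<^sup>2" for k
  define s where "s k = norm (x k - x (Suc k))" for k
  \<comment> \<open>The gap turns the descent inequality into a telescoping bound on both the step
    size and the squared step.\<close>
  have step: "2 * e * \<alpha> k + (1 - 2 * \<delta>) * (s k)\<^sup>2 \<le> d k - d (Suc k)" for k
  proof -
    have "\<alpha> k * e \<le> \<alpha> k * ((F (x (Suc k)) + G (x (Suc k))) - (F u + G u))"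
      using \<alpha>_pos[OF x_in, of k] gap[of "Suc k"] by (intro mult_left_mono) auto
    with descent_seq[OF u, of k] show ?thesis by (simp add: d_def s_def algebra_simps)
  qed
  have pos: "0 \<le> 2 * e * \<alpha> k" "0 \<le> (1 - 2 * \<delta>) * (s k)\<^sup>2" for k
    using \<alpha>_pos[OF x_in, of k] e \<delta> by auto
  have bound: "2 * e * \<alpha> k \<le> d k - d (Suc k)" "(1 - 2 * \<delta>) * (s k)\<^sup>2 \<le> d k - d (Suc k)" for k
    using step[of k] pos[of k] by linarith+
  have "decseq d"
    by (rule decseq_SucI) (metis bound(1) pos(1) order_trans diff_ge_0_iff_ge)
  moreover have "\<And>i. 0 \<le> d i" by (simp add: d_def)
  ultimately obtain l where l: "d \<longlonglongrightarrow> l" using decseq_convergent by blast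
  have dd: "(\<lambda>k. d k - d (Suc k)) \<longlonglongrightarrow> 0"
    using tendsto_diff[OF l LIMSEQ_Suc[OF l]] by simp
  have "(\<lambda>k. 2 * e * \<alpha> k) \<longlonglongrightarrow> 0"
    by (rule tendsto_sandwich[OF _ _ tendsto_const dd])
      (use bound pos in auto)
  then have \<alpha>0: "\<alpha> \<longlonglongrightarrow> 0"
    using tendsto_mult_left_iff[of "2 * e" \<alpha> 0] e by simp
  have "(\<lambda>k. (1 - 2 * \<delta>) * (s k)\<^sup>2) \<longlonglongrightarrow> 0"
    by (rule tendsto_sandwich[OF _ _ tendsto_const dd])
      (use bound pos in auto)
  then have "(\<lambda>k. (s k)\<^sup>2) \<longlonglongrightarrow> 0"
    using tendsto_mult_left_iff[of "1 - 2 * \<delta>" "\<lambda>k. (s k)\<^sup>2" 0] \<delta> by simp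
  then have s0: "s \<longlonglongrightarrow> 0"
    using tendsto_real_sqrt[of "\<lambda>k. (s k)\<^sup>2" 0] by (simp add: s_def[abs_def])
  have "F u + G u \<le> F (x (Suc k)) + G (x (Suc k))" for k using gap[of "Suc k"] e by linarith
  then have "decseq (\<lambda>k. norm (x k - u))" by (intro decseq_SucI fejer[OF u])
  then have R: "norm (x k - u) \<le> norm (x 0 - u)" for k
    by (rule decseqD) simp
  define R where "R = norm (x 0 - u)"
  have sR: "s k \<le> 2 * R" for k
    using R[of k] R[of "Suc k"] norm_triangle_ineq4[of "x k - u" "x (Suc k) - u"]
    by (simp add: s_def R_def)
  define y where "y k = J (x k) (\<alpha> k / \<theta>)" for k
  have trial: "\<alpha> k \<le> \<alpha> k / \<theta>" "0 < \<alpha> k / \<theta>" for k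
    using \<alpha>_pos[OF x_in, of k] \<theta> by (auto simp: field_simps)
  have yD: "y k \<in> D" for k unfolding y_def using x_in trial(2) by (rule J_in)
  \<comment> \<open>Enlarging the step size by the factor \<open>1 / \<theta>\<close> enlarges the
    residual by at most that factor.\<close>
  have xy: "norm (x k - y k) \<le> s k / \<theta>" for k
  proof -
    have "\<alpha> k * norm (x k - y k) \<le> \<alpha> k * (s k / \<theta>)"
      using residual_mono(2)[OF x_in \<alpha>_pos[OF x_in] trial(1), of k] by (simp add: y_def s_def x_Suc)
    then show ?thesis using \<alpha>_pos[OF x_in, of k] by (simp only: mult_le_cancel_left_pos)
  qed
  have "(\<lambda>k. s k / \<theta>) \<longlonglongrightarrow> 0" using tendsto_divide_zero[OF s0] by blast
  then have "(\<lambda>k. dist (x k) (y k)) \<longlonglongrightarrow> 0"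
    by (rule tendsto_sandwich[OF _ _ tendsto_const, rotated 2])
      (auto intro!: always_eventually simp: dist_norm xy)
  \<comment> \<open>This ball holds all iterates and all trial points: a trial point is within
    \<open>2 * R / \<theta>\<close> of its iterate.\<close>
  moreover define B where "B = D \<inter> cball u (R + 2 * R / \<theta>)"
  have R0: "R \<ge> 0" by (simp add: R_def)
  have xy': "norm (x k - y k) \<le> 2 * R / \<theta>" for k
    using order_trans[OF xy divide_right_mono[OF sR]] \<theta> by simp
  have yu: "norm (u - y k) \<le> R + 2 * R / \<theta>" for k
    using norm_triangle_ineq[of "u - x k" "x k - y k"] xy'[of k] R[of k]
    by (simp add: R_def norm_minus_commute)
  have "x k \<in> B" for k
  proof -
    have "0 \<le> 2 * R / \<theta>" using R0 \<theta> by simp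
    with R[of k] have "norm (u - x k) \<le> R + 2 * R / \<theta>"
      unfolding R_def[symmetric] norm_minus_commute[of u] by linarith
    then show ?thesis using x_in by (simp add: B_def dist_norm)
  qed
  moreover have "y k \<in> B" for k using yD yu by (simp add: B_def dist_norm)
  moreover have "uniformly_continuous_on B grad"
    by (rule grad_uniform) (auto simp: B_def intro: bounded_Int)
  ultimately have "(\<lambda>k. dist (grad (x k)) (grad (y k))) \<longlonglongrightarrow> 0"
    unfolding uniformly_continuous_on_sequentially by simp
  then have "(\<lambda>k. norm (grad (y k) - grad (x k))) \<longlonglongrightarrow> 0"
    by (simp add: dist_norm norm_minus_commute)
  moreover define K where "K = R + 2 * R / \<theta> + 2 * R / \<theta> / (2 * \<theta>)"
  have K: "norm (u - y k) + norm (x k - y k) / (2 * \<theta>) \<le> K" for k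
    unfolding K_def using yu[of k] divide_right_mono[OF xy'[of k], of "2 * \<theta>"] \<theta> by simp
  ultimately have lim: "(\<lambda>k. norm (grad (y k) - grad (x k)) / \<delta> * K) \<longlonglongrightarrow> 0"
    by (intro tendsto_mult_left_zero tendsto_divide_zero)
  have "\<forall>\<^sub>F k in sequentially. \<alpha> k < \<sigma>" using order_tendstoD(2)[OF \<alpha>0 \<sigma>] .
  then have "\<forall>\<^sub>F k in sequentially. e \<le> norm (grad (y k) - grad (x k)) / \<delta> * K"
  proof eventually_elim
    case (elim k)
    \<comment> \<open>Here \<open>\<alpha> k < \<sigma>\<close>, so the trial
      \<open>\<alpha> k / \<theta>\<close> was rejected, and its residual quotient is at most the
      gradient variation divided by \<open>\<delta>\<close>.\<close>
    have "\<delta> * norm (x k - y k) < \<alpha> k / \<theta> * norm (grad (y k) - grad (x k))"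
      using rejected[OF x_in, of k] elim
      by (simp add: acceptable_def y_def not_le norm_minus_commute)
    moreover have "n / T \<le> m / \<delta>" if "0 < T" "\<delta> * n < T * m" for n m T :: real
      using that \<delta> by (simp add: divide_simps mult_ac less_imp_le)
    ultimately have "norm (x k - y k) / (\<alpha> k / \<theta>) \<le> norm (grad (y k) - grad (x k)) / \<delta>"
      using trial(2) by blast
    then have "norm (x k - y k) / (\<alpha> k / \<theta>) * (norm (u - y k) + norm (x k - y k) / (2 * \<theta>))
        \<le> norm (grad (y k) - grad (x k)) / \<delta> * K"
      using \<theta> \<delta> K by (intro mult_mono) auto
    moreover have "F (x (Suc k)) + G (x (Suc k)) \<le> F u + G u
        + norm (x k - y k) / (\<alpha> k / \<theta>) * (norm (u - y k) + norm (x k - y k) / (2 * \<theta>))"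
      unfolding x_Suc by (rule accepted_value_bound[OF x_in \<alpha>_pos[OF x_in] accepted[OF x_in] u y_def])
    ultimately show ?case using gap[of "Suc k"] by linarith
  qed
  then have "e \<le> 0" by (intro tendsto_lowerbound[OF lim]) auto
  with e show False by simp
qed

end

section \<open>Extended real valued convex functions\<close>

lemma closed_sublevel_lsc:
  assumes "lsc_fun h"
  shows "closed {y. h y \<le> M}"
proof -
  have "open {y. M < h y}"
  proof (subst open_subopen, safe)
    fix x assume x: "M < h x"
    then have "M < Liminf (at x) h" using assms less_le_trans unfolding lsc_fun_def by blast
    then have "\<forall>\<^sub>F y in at x. M < h y" by (rule less_LiminfD)
    then obtain T where "open T" "x \<in> T" "\<forall>y\<in>T. y \<noteq> x \<longrightarrow> M < h y"
      by (auto simp: eventually_at_topological)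
    \<comment> \<open>The filter \<open>at x\<close> leaves out \<open>x\<close> itself, where the
      bound holds by assumption.\<close>
    with x show "\<exists>T. open T \<and> x \<in> T \<and> T \<subseteq> {y. M < h y}"
      by (intro exI[of _ T]) force
  qed
  then show ?thesis by (simp add: closed_def Compl_eq not_le)
qed

lemma convex_sublevel:
  assumes "convex_fun h" and ninf: "\<And>y. h y \<noteq> -\<infinity>"
  shows "convex {y. h y \<le> ereal c}"
proof (rule convexI)
  fix x y :: 'a and s t :: real
  assume xy: "x \<in> {y. h y \<le> ereal c}" "y \<in> {y. h y \<le> ereal c}"
    and st: "0 \<le> s" "0 \<le> t" "s + t = 1"
  show "s *\<^sub>R x + t *\<^sub>R y \<in> {y. h y \<le> ereal c}"
  \<comment> \<open>\<open>convex_fun\<close> only speaks of weights strictly between 0 and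
    1.\<close>
  proof (cases "t \<in> {0<..<1}")
    case False
    then have "s = 0 \<and> t = 1 \<or> s = 1 \<and> t = 0" using st by auto
    then show ?thesis using xy by auto
  next
    case True
    have s: "s = 1 - t" using st by simp
    obtain a b where ab: "h x = ereal a" "h y = ereal b" "a \<le> c" "b \<le> c"
      using xy ninf[of x] ninf[of y] by (cases "h x"; cases "h y") auto
    have "h (s *\<^sub>R x + t *\<^sub>R y) \<le> ereal (1 - t) * h x + ereal t * h y"
      using assms(1) True unfolding convex_fun_def s by blast
    also have "\<dots> = ereal ((1 - t) * a + t * b)" by (simp add: ab)
    also have "\<dots> \<le> ereal c" using convex_bound_le[of a c b "1 - t" t] ab True by simp
    finally show ?thesis by simp
  qed
qed

text \<open>If the sum exceeds \<open>c\<close>, then \<open>c\<close> splits as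
  \<open>a + b\<close> with \<open>f\<close> above \<open>a\<close> and \<open>g\<close> above
  \<open>b\<close>, and both strict bounds persist nearby. The splitting also covers infinite
  values.\<close>

lemma closed_sublevel_add:
  assumes lsc: "lsc_fun f" "lsc_fun g" and ninf: "\<And>y. f y \<noteq> -\<infinity>" "\<And>y. g y \<noteq> -\<infinity>"
  shows "closed {y. f y + g y \<le> ereal c}"
proof -
  have "open {y. ereal c < f y + g y}"
  proof (subst open_subopen, safe)
    fix x assume x: "ereal c < f x + g x"
    have "\<exists>a b. ereal a < f x \<and> ereal b < g x \<and> c \<le> a + b"
    proof (cases "f x"; cases "g x")
      fix u v assume uv: "f x = ereal u" "g x = ereal v"
      with x show ?thesis
        \<comment> \<open>Half of the excess over \<open>c\<close> is taken from each
          summand.\<close>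
        by (intro exI[of _ "u - (u + v - c) / 2"] exI[of _ "v - (u + v - c) / 2"])
          (auto simp: field_simps)
    next
      fix u assume "f x = ereal u" "g x = \<infinity>"
      then show ?thesis by (intro exI[of _ "u - 1"] exI[of _ "c - u + 1"]) auto
    next
      fix v assume "f x = \<infinity>" "g x = ereal v"
      then show ?thesis by (intro exI[of _ "c - v + 1"] exI[of _ "v - 1"]) auto
    next
      assume "f x = \<infinity>" "g x = \<infinity>"
      then show ?thesis by (intro exI[of _ c] exI[of _ 0]) auto
    qed (use ninf in auto)
    then obtain a b where ab: "ereal a < f x" "ereal b < g x" "c \<le> a + b" by blast
    have "open ({y. ereal a < f y} \<inter> {y. ereal b < g y})"
      using closed_sublevel_lsc[OF lsc(1), of a] closed_sublevel_lsc[OF lsc(2), of b]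
      by (intro open_Int) (simp_all add: closed_def Compl_eq not_le)
    moreover have "ereal c < f y + g y" if "ereal a < f y" "ereal b < g y" for y
    proof -
      have "ereal c \<le> ereal a + ereal b" using ab(3) by simp
      also have "\<dots> < f y + g y" using that by (rule ereal_add_strict_mono2)
      finally show ?thesis .
    qed
    ultimately show "\<exists>T. open T \<and> x \<in> T \<and> T \<subseteq> {y. ereal c < f y + g y}"
      using ab by (intro exI[of _ "{y. ereal a < f y} \<inter> {y. ereal b < g y}"]) auto
  qed
  then show ?thesis by (simp add: closed_def Compl_eq not_le)
qed

lemma convex_fun_add:
  assumes "convex_fun f" "convex_fun g" and ninf: "\<And>y. f y \<noteq> -\<infinity>" "\<And>y. g y \<noteq> -\<infinity>"
  shows "convex_fun (\<lambda>y. f y + g y)"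
  unfolding convex_fun_def
proof (intro allI ballI)
  fix x y :: 'a and t :: real assume t: "t \<in> {0<..<1}"
  let ?w = "(1 - t) *\<^sub>R x + t *\<^sub>R y"
  have "f ?w + g ?w \<le> (ereal (1 - t) * f x + ereal t * f y) + (ereal (1 - t) * g x + ereal t * g y)"
    using assms(1,2) t unfolding convex_fun_def by (intro add_mono) blast+
  also have "\<dots> = ereal (1 - t) * (f x + g x) + ereal t * (f y + g y)"
    using t ninf[of x] ninf[of y]
    by (cases "f x"; cases "f y"; cases "g x"; cases "g y") (auto simp: algebra_simps)
  finally show "f ?w + g ?w \<le> ereal (1 - t) * (f x + g x) + ereal t * (f y + g y)" .
qed

section \<open>From extended real functions to real functions on the domain\<close>

lemma edom_real:
  assumes "proper_fun h" "x \<in> edom h"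
  shows "h x = ereal (real_of_ereal (h x))"
  using assms by (cases "h x") (auto simp: proper_fun_def edom_def)

lemma convex_on_edom:
  assumes h: "proper_fun h" and conv: "convex_fun h"
  shows "convex_on (edom h) (\<lambda>x. real_of_ereal (h x))"
proof -
  have *: "h ((1 - t) *\<^sub>R x + t *\<^sub>R y) \<le> ereal ((1 - t) * real_of_ereal (h x) + t * real_of_ereal (h y))"
    if "x \<in> edom h" "y \<in> edom h" "0 < t" "t < 1" for x y t
  proof -
    have "h ((1 - t) *\<^sub>R x + t *\<^sub>R y) \<le> ereal (1 - t) * h x + ereal t * h y"
      using conv that unfolding convex_fun_def by auto
    also have "\<dots> = ereal ((1 - t) * real_of_ereal (h x) + t * real_of_ereal (h y))"
      using edom_real[OF h that(1)] edom_real[OF h that(2)]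
      by (metis plus_ereal.simps(1) times_ereal.simps(1))
    finally show ?thesis .
  qed
  have in_dom: "(1 - t) *\<^sub>R x + t *\<^sub>R y \<in> edom h"
    if "x \<in> edom h" "y \<in> edom h" "0 < t" "t < 1" for x y t
    using *[OF that] by (auto simp: edom_def intro: le_less_trans)
  show ?thesis
  proof (rule convex_onI)
    show "convex (edom h)"
    proof (subst convex_alt, intro ballI allI impI)
      fix x y t assume "x \<in> edom h" "y \<in> edom h" "0 \<le> (t::real) \<and> t \<le> 1"
      then show "(1 - t) *\<^sub>R x + t *\<^sub>R y \<in> edom h"
        using in_dom[of x y t] by (cases "t = 0 \<or> t = 1") auto
    qed
  next
    fix t x y assume t: "(0::real) < t" "t < 1" and xy: "x \<in> edom h" "y \<in> edom h"
    have "ereal (real_of_ereal (h ((1 - t) *\<^sub>R x + t *\<^sub>R y)))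
      \<le> ereal ((1 - t) * real_of_ereal (h x) + t * real_of_ereal (h y))"
      using *[OF xy t] edom_real[OF h in_dom[OF xy t]] by simp
    then show "real_of_ereal (h ((1 - t) *\<^sub>R x + t *\<^sub>R y))
      \<le> (1 - t) * real_of_ereal (h x) + t * real_of_ereal (h y)" by simp
  qed
qed

lemma closed_convex_function_edom:
  fixes h :: "'a::{real_inner,complete_space} \<Rightarrow> ereal"
  assumes h: "proper_fun h" and lsc: "lsc_fun h" and conv: "convex_fun h"
  shows "closed_convex_function (edom h) (\<lambda>x. real_of_ereal (h x))"
proof
  show "edom h \<noteq> {}" using h by (simp add: proper_fun_def)
  show "convex_on (edom h) (\<lambda>x. real_of_ereal (h x))" using h conv by (rule convex_on_edom)
  fix M
  have "h y \<le> ereal M \<longleftrightarrow> y \<in> edom h \<and> real_of_ereal (h y) \<le> M" for y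
    using h by (cases "h y") (auto simp: edom_def proper_fun_def)
  then show "closed {y \<in> edom h. real_of_ereal (h y) \<le> M}"
    using closed_sublevel_lsc[OF lsc, of "ereal M"] by simp
qed

lemma subdifferential_iff:
  assumes h: "proper_fun h"
  shows "v \<in> subdifferential h p \<longleftrightarrow>
    p \<in> edom h \<and> (\<forall>y\<in>edom h. real_of_ereal (h p) + v \<bullet> (y - p) \<le> real_of_ereal (h y))"
proof safe
  assume v: "v \<in> subdifferential h p"
  \<comment> \<open>A point of finite value rules out \<open>h p = \<infinity>\<close>.\<close>
  obtain y0 where "y0 \<in> edom h" using h by (auto simp: proper_fun_def)
  moreover have "h p + ereal (v \<bullet> (y0 - p)) \<le> h y0" using v by (simp add: subdifferential_def)
  ultimately show p: "p \<in> edom h" by (cases "h p") (auto simp: edom_def)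
  fix y assume y: "y \<in> edom h"
  have "h p + ereal (v \<bullet> (y - p)) \<le> h y" using v by (simp add: subdifferential_def)
  then show "real_of_ereal (h p) + v \<bullet> (y - p) \<le> real_of_ereal (h y)"
    using edom_real[OF h p] edom_real[OF h y] by (metis ereal_less_eq(3) plus_ereal.simps(1))
next
  assume p: "p \<in> edom h"
    and le: "\<forall>y\<in>edom h. real_of_ereal (h p) + v \<bullet> (y - p) \<le> real_of_ereal (h y)"
  have "h p + ereal (v \<bullet> (y - p)) \<le> h y" for y
  proof (cases "y \<in> edom h")
    case True
    with le have "ereal (real_of_ereal (h p)) + ereal (v \<bullet> (y - p)) \<le> ereal (real_of_ereal (h y))"
      by simp
    then show ?thesis using edom_real[OF h p] edom_real[OF h True] by simp
  qed (simp add: edom_def)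
  then show "v \<in> subdifferential h p" by (simp add: subdifferential_def)
qed

text \<open>Existence comes from the proximal minimizer and uniqueness from monotonicity of the
  subdifferential; together they determine the definite description in \<open>prox\<close>.\<close>

lemma prox_spec:
  fixes h :: "'a::{real_inner,complete_space} \<Rightarrow> ereal"
  assumes h: "proper_fun h" and lsc: "lsc_fun h" and conv: "convex_fun h" and a: "a > 0"
  shows "prox a h z \<in> edom h"
    and "y \<in> edom h \<Longrightarrow> real_of_ereal (h (prox a h z)) + ((z - prox a h z) /\<^sub>R a) \<bullet> (y - prox a h z)
      \<le> real_of_ereal (h y)"
proof -
  let ?P = "\<lambda>p. \<exists>v\<in>subdifferential h p. z = p + a *\<^sub>R v"
  interpret closed_convex_function "edom h" "\<lambda>x. real_of_ereal (h x)"
    by (rule closed_convex_function_edom[OF h lsc conv])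
  obtain p where p: "p \<in> edom h" "\<And>y. y \<in> edom h \<Longrightarrow>
      real_of_ereal (h p) + ((z - p) /\<^sub>R a) \<bullet> (y - p) \<le> real_of_ereal (h y)"
    using proximal_point_exists[OF a] by blast
  then have "(z - p) /\<^sub>R a \<in> subdifferential h p" by (simp add: subdifferential_iff[OF h])
  then have Pp: "?P p" using a by (intro bexI[of _ "(z - p) /\<^sub>R a"]) auto
  have "q = p" if q: "?P q" for q
  proof -
    obtain v w where v: "v \<in> subdifferential h p" "z = p + a *\<^sub>R v"
      and w: "w \<in> subdifferential h q" "z = q + a *\<^sub>R w" using Pp q by blast
    have "v \<bullet> (q - p) + w \<bullet> (p - q) \<le> 0"
      using v(1) w(1) unfolding subdifferential_iff[OF h] by fastforce
    moreover have qp: "q - p = a *\<^sub>R (v - w)" "p - q = a *\<^sub>R (w - v)"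
      using v(2) w(2) by (simp_all add: algebra_simps)
    ultimately have "a * ((v - w) \<bullet> (v - w)) \<le> 0" by (simp add: algebra_simps)
    then have "(v - w) \<bullet> (v - w) \<le> 0" using a by (simp add: mult_le_0_iff)
    then have "v = w" by (metis antisym eq_iff_diff_eq_0 inner_eq_zero_iff inner_ge_zero)
    with qp show ?thesis by simp
  qed
  with Pp have "prox a h z = p" unfolding prox_def by (rule the_equality)
  with p show "prox a h z \<in> edom h"
    and "y \<in> edom h \<Longrightarrow> real_of_ereal (h (prox a h z)) + ((z - prox a h z) /\<^sub>R a) \<bullet> (y - prox a h z)
      \<le> real_of_ereal (h y)" by auto
qed

text \<open>Riesz representation supplies a gradient, and uniqueness of derivatives makes it the one
  described by \<open>gradient\<close>.\<close>

lemma gradient_spec: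
  fixes h :: "'a::{real_inner,complete_space} \<Rightarrow> ereal"
  assumes "(\<lambda>y. real_of_ereal (h y)) differentiable (at x)"
  shows "GDERIV (\<lambda>y. real_of_ereal (h y)) x :> gradient h x"
proof -
  obtain L where L: "((\<lambda>y. real_of_ereal (h y)) has_derivative L) (at x)"
    using assms by (auto simp: differentiable_def)
  obtain d where "\<And>v. L v = v \<bullet> d"
    using riesz_representation[OF has_derivative_bounded_linear[OF L]] by blast
  then have "L = (\<lambda>v. v \<bullet> d)" by blast
  then have d: "GDERIV (\<lambda>y. real_of_ereal (h y)) x :> d"
    using L by (simp add: gderiv_def)
  moreover have "d' = d" if "GDERIV (\<lambda>y. real_of_ereal (h y)) x :> d'" for d'
    using has_derivative_unique[OF that[unfolded gderiv_def] d[unfolded gderiv_def]]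
    by (metis vector_eq_ldot)
  ultimately show ?thesis unfolding gradient_def by (rule theI)
qed

text \<open>By convexity the difference quotients towards \<open>y\<close> are at most the total
  increment; their limit at 0 is the directional derivative.\<close>

lemma gradient_inequality:
  fixes h :: "'a::{real_inner,complete_space} \<Rightarrow> ereal"
  assumes h: "proper_fun h" and conv: "convex_fun h"
    and diff: "(\<lambda>y. real_of_ereal (h y)) differentiable (at x)"
    and x: "x \<in> edom h" and y: "y \<in> edom h"
  shows "real_of_ereal (h x) + gradient h x \<bullet> (y - x) \<le> real_of_ereal (h y)"
proof -
  define F where "F = (\<lambda>y. real_of_ereal (h y))"
  let ?w = "\<lambda>t. x + t *\<^sub>R (y - x)"
  have w: "(?w has_derivative (\<lambda>t. t *\<^sub>R (y - x))) (at 0)"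
    by (auto intro!: derivative_eq_intros)
  have "(F has_derivative (\<lambda>v. v \<bullet> gradient h x)) (at (?w 0))"
    using gradient_spec[OF diff] by (simp add: gderiv_def F_def)
  from has_derivative_compose[OF w this]
  have "((\<lambda>t. F (?w t)) has_real_derivative (gradient h x \<bullet> (y - x))) (at 0)"
    unfolding has_field_derivative_def
    by (rule has_derivative_eq_rhs) (simp add: fun_eq_iff inner_commute)
  then have "((\<lambda>t. (F (?w t) - F x) / t) \<longlongrightarrow> gradient h x \<bullet> (y - x)) (at 0)"
    by (simp add: has_field_derivative_iff)
  then have lim: "((\<lambda>t. (F (?w t) - F x) / t) \<longlongrightarrow> gradient h x \<bullet> (y - x)) (at_right 0)"
    by (rule filterlim_mono) (auto simp: at_le)
  have le: "(F (?w t) - F x) / t \<le> F y - F x" if t: "0 < t" "t < 1" for t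
  proof -
    have "F ((1 - t) *\<^sub>R x + t *\<^sub>R y) \<le> (1 - t) * F x + t * F y"
      using convex_onD[OF convex_on_edom[OF h conv] _ _ x y, of t] t by (simp add: F_def)
    moreover have "(1 - t) *\<^sub>R x + t *\<^sub>R y = ?w t" by (simp add: algebra_simps)
    ultimately show ?thesis using t by (simp add: field_simps)
  qed
  have "\<forall>\<^sub>F t in at_right 0. (F (?w t) - F x) / t \<le> F y - F x"
    using eventually_at_right_real[of 0 1] by (rule eventually_mono) (use le in auto)
  then have "gradient h x \<bullet> (y - x) \<le> F y - F x"
    by (intro tendsto_upperbound[OF lim]) auto
  then show ?thesis by (simp add: F_def)
qed

text \<open>One acceptable trial guarantees termination, so \<open>while\<close> has a specified
  value: the trial with the least acceptable exponent.\<close>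

lemma linesearch1_result:
  fixes f g :: "'a::real_inner \<Rightarrow> ereal" and \<delta> :: real
  defines "ok \<equiv> \<lambda>x a. a * norm (gradient f (fb_step f g x a) - gradient f x)
    \<le> \<delta> * norm (fb_step f g x a - x)"
  assumes "ok x (\<sigma> * \<theta> ^ n)"
  obtains m where "linesearch1 f g x \<sigma> \<theta> \<delta> = \<sigma> * \<theta> ^ m" "ok x (\<sigma> * \<theta> ^ m)"
    "\<And>i. i < m \<Longrightarrow> \<not> ok x (\<sigma> * \<theta> ^ i)"
proof -
  have pow: "((\<lambda>a. \<theta> * a) ^^ i) \<sigma> = \<sigma> * \<theta> ^ i" for i by (induction i) auto
  define m where "m = (LEAST i. ok x (\<sigma> * \<theta> ^ i))"
  have "linesearch1 f g x \<sigma> \<theta> \<delta> = while (\<lambda>a. \<not> ok x a) (\<lambda>a. \<theta> * a) \<sigma>"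
    by (simp add: linesearch1_def ok_def not_le)
  also have "\<dots> = \<sigma> * \<theta> ^ m"
    using assms(2) unfolding while_def while_option_def pow m_def not_not
    by (subst if_P) (blast, rule option.sel)
  finally show ?thesis
    by (rule that) (auto simp: m_def intro: LeastI[of "\<lambda>i. ok x (\<sigma> * \<theta> ^ i)", OF assms(2)]
        dest: not_less_Least)
qed

section \<open>Weak convergence\<close>

text \<open>Weak cluster points satisfy this, by weak closedness of closed convex sets. Existence for
  bounded sequences, however, only needs nested closed convex sets to intersect, which makes weak
  compactness dispensable.\<close>

definition tail_point :: "(nat \<Rightarrow> 'a::real_inner) \<Rightarrow> 'a \<Rightarrow> bool" where
  "tail_point y p \<longleftrightarrow>
     (\<forall>K. closed K \<longrightarrow> convex K \<longrightarrow> (\<forall>\<^sub>F k in sequentially. y k \<in> K) \<longrightarrow> p \<in> K)"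

lemma tail_pointD:
  "tail_point y p \<Longrightarrow> closed K \<Longrightarrow> convex K \<Longrightarrow> \<forall>\<^sub>F k in sequentially. y k \<in> K \<Longrightarrow> p \<in> K"
  by (simp add: tail_point_def)

lemma tail_point_subseq:
  assumes "tail_point (y \<circ> r) p" "strict_mono r"
  shows "tail_point y p"
  using assms eventually_subseq[OF assms(2)] by (auto simp: tail_point_def)

text \<open>The closed convex hulls of the tails are nested and bounded, and a closed convex set
  that eventually contains the sequence contains one of them.\<close>

lemma tail_point_exists:
  fixes y :: "nat \<Rightarrow> 'a::{real_inner,complete_space}"
  assumes "bounded (range y)"
  obtains p where "tail_point y p"
proof -
  define C where "C n = closure (convex hull (y ` {n..}))" for n
  have "\<exists>p. \<forall>n. p \<in> C n"
  proof (rule nested_closed_convex_Inter[of C])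
    show "decseq C"
      unfolding C_def by (intro antimonoI closure_mono hull_mono image_mono) auto
    have "bounded (y ` {0..})" using assms by (rule bounded_subset) auto
    then show "bounded (C 0)" unfolding C_def by (intro bounded_closure bounded_convex_hull)
  qed (auto simp: C_def convex_closure)
  then obtain p where p: "\<And>n. p \<in> C n" by blast
  have "p \<in> K" if K: "closed K" "convex K" and ev: "\<forall>\<^sub>F k in sequentially. y k \<in> K" for K
  proof -
    obtain n where "y ` {n..} \<subseteq> K" using ev by (auto simp: eventually_sequentially)
    then have "C n \<subseteq> K" unfolding C_def using K by (intro closure_minimal hull_minimal) auto
    with p show ?thesis by blast
  qed
  then show ?thesis by (intro that[of p]) (simp add: tail_point_def)
qed

text \<open>Half-spaces are closed and convex, so eventual bounds on the inner products pass to the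
  tail point.\<close>

lemma tail_point_inner_limit:
  assumes "tail_point y p" and lim: "(\<lambda>k. y k \<bullet> w) \<longlonglongrightarrow> l"
  shows "p \<bullet> w = l"
proof (rule antisym)
  show "p \<bullet> w \<le> l"
  proof (rule field_le_epsilon)
    fix e :: real assume "e > 0"
    then have "\<forall>\<^sub>F k in sequentially. y k \<bullet> w < l + e" by (intro order_tendstoD(2)[OF lim]) simp
    then have "\<forall>\<^sub>F k in sequentially. y k \<in> {v. w \<bullet> v \<le> l + e}"
      by eventually_elim (simp add: inner_commute)
    then have "p \<in> {v. w \<bullet> v \<le> l + e}"
      by (rule tail_pointD[OF assms(1) closed_halfspace_le convex_halfspace_le])
    then show "p \<bullet> w \<le> l + e" by (simp add: inner_commute)
  qed
  show "l \<le> p \<bullet> w"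
  proof (rule field_le_epsilon)
    fix e :: real assume "e > 0"
    then have "\<forall>\<^sub>F k in sequentially. l - e < y k \<bullet> w" by (intro order_tendstoD(1)[OF lim]) simp
    then have "\<forall>\<^sub>F k in sequentially. y k \<in> {v. w \<bullet> v \<ge> l - e}"
      by eventually_elim (simp add: inner_commute)
    then have "p \<in> {v. w \<bullet> v \<ge> l - e}"
      by (rule tail_pointD[OF assms(1) closed_halfspace_ge convex_halfspace_ge])
    then show "l \<le> p \<bullet> w + e" by (simp add: inner_commute)
  qed
qed

text \<open>The argument of Opial's lemma: for two tail points \<open>p\<close>, \<open>q\<close> the inner products with
  \<open>q - p\<close> converge, which forces \<open>p = q\<close>.\<close>

lemma opial_weak_convergence:
  fixes y :: "nat \<Rightarrow> 'a::{real_inner,complete_space}"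
  assumes bdd: "bounded (range y)"
    and dist: "\<And>s. s \<in> S \<Longrightarrow> convergent (\<lambda>k. norm (y k - s))"
    and tail: "\<And>p. tail_point y p \<Longrightarrow> p \<in> S"
  shows "\<exists>p\<in>S. weakly_converges y p"
proof -
  obtain p where p: "tail_point y p" using tail_point_exists[OF bdd] .
  have unique: "q = p" if q: "tail_point y q" for q
  proof -
    \<comment> \<open>In the difference of the squared distances to \<open>p\<close> and
      \<open>q\<close> the quadratic term in \<open>y k\<close> cancels, leaving a linear
      one.\<close>
    obtain a b where "(\<lambda>k. norm (y k - p)) \<longlonglongrightarrow> a" "(\<lambda>k. norm (y k - q)) \<longlonglongrightarrow> b"
      using dist[OF tail[OF p]] dist[OF tail[OF q]] by (auto simp: convergent_def)
    then have "(\<lambda>k. ((norm (y k - p))\<^sup>2 - (norm (y k - q))\<^sup>2 - (p \<bullet> p - q \<bullet> q)) / 2)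
        \<longlonglongrightarrow> (a\<^sup>2 - b\<^sup>2 - (p \<bullet> p - q \<bullet> q)) / 2"
      by (intro tendsto_intros) auto
    moreover have "((norm (y k - p))\<^sup>2 - (norm (y k - q))\<^sup>2 - (p \<bullet> p - q \<bullet> q)) / 2 = y k \<bullet> (q - p)" for k
      unfolding power2_norm_eq_inner by (simp add: algebra_simps inner_commute diff_divide_distrib)
    ultimately have "(\<lambda>k. y k \<bullet> (q - p)) \<longlonglongrightarrow> (a\<^sup>2 - b\<^sup>2 - (p \<bullet> p - q \<bullet> q)) / 2" by simp
    from tail_point_inner_limit[OF p this] tail_point_inner_limit[OF q this]
    have "(q - p) \<bullet> (q - p) = 0" by (simp add: inner_diff_left)
    then show ?thesis by simp
  qed
  \<comment> \<open>Otherwise a subsequence stays in a half-space that excludes \<open>p\<close>,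
    although its tail point must be \<open>p\<close>.\<close>
  have upper: "\<forall>\<^sub>F k in sequentially. y k \<bullet> w < p \<bullet> w + e" if e: "e > 0" for w e
  proof (rule ccontr)
    assume "\<not> ?thesis"
    then obtain r :: "nat \<Rightarrow> nat" where r: "strict_mono r" "\<And>k. \<not> y (r k) \<bullet> w < p \<bullet> w + e"
      using not_eventually_sequentiallyD by blast
    have "bounded (range (y \<circ> r))" using bdd by (rule bounded_subset) auto
    then obtain q where q: "tail_point (y \<circ> r) q" using tail_point_exists by blast
    have "q \<in> {v. w \<bullet> v \<ge> p \<bullet> w + e}"
      by (rule tail_pointD[OF q closed_halfspace_ge convex_halfspace_ge])
        (use r(2) in \<open>auto simp: inner_commute not_less\<close>)
    moreover have "q = p" using unique tail_point_subseq[OF q r(1)] by blast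
    ultimately show False using e by (simp add: inner_commute)
  qed
  have "(\<lambda>k. y k \<bullet> w) \<longlonglongrightarrow> p \<bullet> w" for w
  proof (rule LIMSEQ_I)
    fix e :: real assume "e > 0"
    from upper[OF this, of w] upper[OF this, of "- w"]
    have "\<forall>\<^sub>F k in sequentially. norm (y k \<bullet> w - p \<bullet> w) < e"
      by eventually_elim (simp add: abs_less_iff)
    then show "\<exists>n. \<forall>k\<ge>n. norm (y k \<bullet> w - p \<bullet> w) < e" by (simp add: eventually_sequentially)
  qed
  then show ?thesis using tail[OF p] by (auto simp: weakly_converges_def)
qed

section \<open>Convergence of the method\<close>

theorem theorem4p2:
  fixes f g :: "'a::{real_inner,complete_space} \<Rightarrow> ereal"
    and x :: "nat \<Rightarrow> 'a" and \<alpha> :: "nat \<Rightarrow> real"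
    and \<sigma> \<theta> \<delta> :: real
  assumes "proper_fun f" and "lsc_fun f" and "convex_fun f"
    and "proper_fun g" and "lsc_fun g" and "convex_fun g"
    and "edom g \<subseteq> edom f"
    and "\<exists>U. edom g \<subseteq> U \<and> frechet_differentiable_on f U"
    and "\<And>B. B \<subseteq> edom g \<Longrightarrow> bounded B \<Longrightarrow> uniformly_continuous_on B (gradient f)"
    and "\<And>B. B \<subseteq> edom g \<Longrightarrow> bounded B \<Longrightarrow> bounded (gradient f ` B)"
    and "\<sigma> > 0" and "0 < \<theta>" and "\<theta> < 1" and "0 < \<delta>" and "\<delta> < 1 / 2"
    and "generated_by_method1 f g \<sigma> \<theta> \<delta> x \<alpha>"
  shows
    "(minimizers (\<lambda>y. f y + g y) \<noteq> {} \<longrightarrow>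
        (\<exists>p \<in> minimizers (\<lambda>y. f y + g y). weakly_converges x p) \<and>
        (\<lambda>k. f (x k) + g (x k)) \<longlonglongrightarrow> (INF y. f y + g y)) \<and>
     (minimizers (\<lambda>y. f y + g y) = {} \<longrightarrow>
        filterlim (\<lambda>k. norm (x k)) at_top sequentially \<and>
        (\<lambda>k. f (x k) + g (x k)) \<longlonglongrightarrow> (INF y. f y + g y))"
proof -
  define F where "F = (\<lambda>y. real_of_ereal (f y))"
  define G where "G = (\<lambda>y. real_of_ereal (g y))"
  interpret forward_backward "edom g" F G "gradient f" "fb_step f g" \<theta> \<delta>
  proof
    obtain U where U: "edom g \<subseteq> U" "frechet_differentiable_on f U" using assms(8) by blast
    show "F x + gradient f x \<bullet> (y - x) \<le> F y" if "x \<in> edom g" "y \<in> edom g" for x y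
      unfolding F_def using assms(7) U that
      by (intro gradient_inequality[OF assms(1,3)]) (auto simp: frechet_differentiable_on_def)
    show "fb_step f g x a \<in> edom g" if "a > 0" for x a
      unfolding fb_step_def using prox_spec(1)[OF assms(4-6) that] .
    show "G (fb_step f g x a) + ((x - fb_step f g x a) /\<^sub>R a - gradient f x) \<bullet> (y - fb_step f g x a) \<le> G y"
      if a: "a > 0" and y: "y \<in> edom g" for x a y
    proof -
      have "(x - fb_step f g x a) /\<^sub>R a - gradient f x = (x - a *\<^sub>R gradient f x - fb_step f g x a) /\<^sub>R a"
        using a by (simp add: algebra_simps)
      then show ?thesis
        using prox_spec(2)[OF assms(4-6) a y, of "x - a *\<^sub>R gradient f x"]
        by (simp add: fb_step_def G_def)
    qed
  qed (use assms in auto)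
  have gen: "x 0 \<in> edom g" "\<And>k. \<alpha> k = linesearch1 f g (x k) \<sigma> \<theta> \<delta>"
    "\<And>k. x (Suc k) = fb_step f g (x k) (\<alpha> k)"
    using assms(16) by (auto simp: generated_by_method1_def)
  have step: "\<exists>m. \<alpha> k = \<sigma> * \<theta> ^ m \<and> acceptable (x k) (\<sigma> * \<theta> ^ m) \<and>
      (\<forall>i<m. \<not> acceptable (x k) (\<sigma> * \<theta> ^ i))" if xk: "x k \<in> edom g" for k
  proof -
    obtain n where "acceptable (x k) (\<sigma> * \<theta> ^ n)" using linesearch_terminates[OF xk assms(11)] .
    from linesearch1_result[OF this[unfolded acceptable_def]] show ?thesis
      unfolding gen(2) acceptable_def by metis
  qed
  interpret forward_backward_sequence "edom g" F G "gradient f" "fb_step f g" \<theta> \<delta> \<sigma> x \<alpha>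
  proof
    fix k assume xk: "x k \<in> edom g"
    then obtain m where m: "\<alpha> k = \<sigma> * \<theta> ^ m" "acceptable (x k) (\<sigma> * \<theta> ^ m)"
      "\<And>i. i < m \<Longrightarrow> \<not> acceptable (x k) (\<sigma> * \<theta> ^ i)" using step by blast
    show "\<alpha> k > 0" "acceptable (x k) (\<alpha> k)" using m assms(11,12) by auto
    \<comment> \<open>The exponent is positive here, and dividing by \<open>\<theta>\<close> lowers
      it by one, to a rejected trial.\<close>
    assume "\<alpha> k \<noteq> \<sigma>"
    then obtain i where "m = Suc i" using m(1) by (cases m) auto
    then show "\<not> acceptable (x k) (\<alpha> k / \<theta>)" using m(1) m(3)[of i] assms(12) by simp
  qed (use gen assms(11) in auto)
  define \<phi> where "\<phi> = (\<lambda>y. f y + g y)"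
  have ninf: "f y \<noteq> -\<infinity>" "g y \<noteq> -\<infinity>" for y
    using assms(1,4) by (auto simp: proper_fun_def)
  have \<phi>_real: "\<phi> y = ereal (F y + G y)" if "y \<in> edom g" for y
    using edom_real[OF assms(1), of y] edom_real[OF assms(4), of y] assms(7) that
    unfolding \<phi>_def F_def G_def by (metis plus_ereal.simps(1) subsetD)
  have \<phi>_top: "\<phi> y = \<infinity>" if "y \<notin> edom g" for y
    using that ninf(1)[of y] by (simp add: \<phi>_def edom_def)
  have \<phi>_x: "\<phi> (x k) = ereal (F (x k) + G (x k))" for k using \<phi>_real[OF x_in] .
  have dec: "decseq (\<lambda>k. \<phi> (x k))"
    by (rule decseq_SucI) (simp add: \<phi>_x values_decrease)
  \<comment> \<open>The values decrease to their infimum along the sequence, so it remains to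
    identify it with the global infimum.\<close>
  have "(INF k. \<phi> (x k)) \<le> \<phi> y" for y
  proof (cases "y \<in> edom g")
    case True
    show ?thesis
    proof (rule ereal_le_epsilon2)
      fix e :: real assume "0 < e"
      then obtain k where "F (x k) + G (x k) < F y + G y + e"
        using values_approach_infimum[OF True] by blast
      then have "\<phi> (x k) \<le> \<phi> y + ereal e" by (simp add: \<phi>_x \<phi>_real[OF True])
      then show "(INF k. \<phi> (x k)) \<le> \<phi> y + ereal e" by (rule INF_lower2[OF UNIV_I])
    qed
  qed (simp add: \<phi>_top)
  then have "(INF k. \<phi> (x k)) = (INF y. \<phi> y)"
    by (intro antisym INF_greatest) (auto intro: INF_lower)
  then have lim: "(\<lambda>k. \<phi> (x k)) \<longlonglongrightarrow> (INF y. \<phi> y)" using LIMSEQ_INF[OF dec] by simp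
  have tail: "p \<in> minimizers \<phi>" if p: "tail_point x p" for p
  proof -
    have "\<phi> p \<le> \<phi> (x k)" for k
    proof -
      \<comment> \<open>As the values decrease, this set contains all later iterates.\<close>
      let ?K = "{y. \<phi> y \<le> ereal (F (x k) + G (x k))}"
      have "closed ?K" unfolding \<phi>_def by (rule closed_sublevel_add[OF assms(2,5) ninf])
      moreover have "convex ?K"
        unfolding \<phi>_def using convex_fun_add[OF assms(3,6) ninf] ninf by (intro convex_sublevel) auto
      moreover have "\<forall>\<^sub>F j in sequentially. x j \<in> ?K"
        unfolding eventually_sequentially \<phi>_x[symmetric] using decseqD[OF dec, of k] by blast
      ultimately have "p \<in> ?K" by (rule tail_pointD[OF p])
      then show ?thesis by (simp add: \<phi>_x)
    qed
    then have "\<phi> p \<le> (INF y. \<phi> y)" using LIMSEQ_le_const[OF lim] by blast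
    then have "\<phi> p \<le> \<phi> y" for y by (rule order_trans) (rule INF_lower[OF UNIV_I])
    then show ?thesis by (simp add: minimizers_def)
  qed
  have "\<exists>p\<in>minimizers \<phi>. weakly_converges x p" if ne: "minimizers \<phi> \<noteq> {}"
  proof -
    \<comment> \<open>A minimizer lies below all values, so Fejer monotonicity applies; it belongs
      to \<open>edom g\<close> since its value is at most the finite one at
      \<open>x 0\<close>.\<close>
    have dist: "decseq (\<lambda>k. norm (x k - s))" if s: "s \<in> minimizers \<phi>" for s
    proof -
      have le: "\<phi> s \<le> \<phi> (x k)" for k using s by (simp add: minimizers_def)
      have sD: "s \<in> edom g" using le[of 0] \<phi>_top[of s] unfolding \<phi>_x by force
      show ?thesis
        by (rule decseq_SucI, rule fejer[OF sD]) (use le in \<open>simp add: \<phi>_x \<phi>_real[OF sD]\<close>)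
    qed
    obtain s where s: "s \<in> minimizers \<phi>" using ne by blast
    have "dist s (x k) \<le> norm (x 0 - s)" for k
      using decseqD[OF dist[OF s], of 0 k] by (simp add: dist_norm norm_minus_commute)
    then have "bounded (range x)" unfolding bounded_def by blast
    moreover have "convergent (\<lambda>k. norm (x k - s))" if "s \<in> minimizers \<phi>" for s
      using decseq_convergent[OF dist[OF that], of 0] by (auto simp: convergent_def)
    ultimately show ?thesis using tail by (rule opial_weak_convergence)
  qed
  moreover have "filterlim (\<lambda>k. norm (x k)) at_top sequentially" if empty: "minimizers \<phi> = {}"
    unfolding filterlim_at_top
  proof (rule allI, rule ccontr)
    fix Z
    assume "\<not> (\<forall>\<^sub>F k in sequentially. Z \<le> norm (x k))"
    \<comment> \<open>Otherwise some subsequence is bounded, and its tail point would be a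
      minimizer.\<close>
    then obtain r :: "nat \<Rightarrow> nat" where r: "strict_mono r" "\<And>k. \<not> Z \<le> norm (x (r k))"
      using not_eventually_sequentiallyD by blast
    have "norm ((x \<circ> r) k) \<le> Z" for k using r(2)[of k] by simp
    then have "bounded (range (x \<circ> r))" unfolding bounded_iff by blast
    then obtain p where p: "tail_point (x \<circ> r) p" using tail_point_exists by blast
    have "p \<in> minimizers \<phi>" by (rule tail[OF tail_point_subseq[OF p r(1)]])
    with empty show False by simp
  qed
  ultimately show ?thesis using lim unfolding \<phi>_def by blast
qed

end
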